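(* Let $A$ be an evolution $\mathbb{K}$-algebra with natural basis $B=\{e_i\}_{i\in\Lambda}$ and let $I$ be an ideal of $A$. The following assertions are equivalent: (1) $I$ has the absorption property. (2) $H_I=I\cap B$. (3) $I=I_{H_I}$.
   Context: An evolution algebra over a field $\mathbb{K}$ is a (not necessarily associative or finite-dimensional) $\mathbb{K}$-algebra $A$ having a basis $B=\{e_i\}_{i\in\Lambda}$, called a natural basis, with $e_ie_j=0$ whenever $i\neq j$. An ideal $I$ of a commutative algebra $A$ has the absorption property if $xA\subset I$ implies $x\in I$. For an ideal $I$ of $A$, $H_I:=\{e_i\in B: e_i^2\in I\}$, and $I_{H_I}:=\operatorname{span}(H_I)$. *)

theory Defs
  imports Complex_Main
begin

text \<open>
  The algebra is the whole type \<open>'a\<close>, over the field \<open>'k\<close>. The product is only required to be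
  bilinear. It is not assumed to be associative, commutative or unital.
\<close>

locale nonassoc_algebra = vector_space scale
  for scale :: "'k::field \<Rightarrow> 'a::ab_group_add \<Rightarrow> 'a" (infixr \<open>*s\<close> 75) +
  fixes mult :: "'a \<Rightarrow> 'a \<Rightarrow> 'a" (infixl \<open>\<bullet>\<close> 70)
  assumes mult_add_left: "(x + y) \<bullet> z = x \<bullet> z + y \<bullet> z"
    and mult_add_right: "x \<bullet> (y + z) = x \<bullet> y + x \<bullet> z"
    and mult_scale_left: "(c *s x) \<bullet> y = c *s (x \<bullet> y)"
    and mult_scale_right: "x \<bullet> (c *s y) = c *s (x \<bullet> y)"
begin

definition ideal :: "'a set \<Rightarrow> bool" where
  "ideal I \<longleftrightarrow> subspace I \<and> (\<forall>x\<in>I. \<forall>a. x \<bullet> a \<in> I \<and> a \<bullet> x \<in> I)"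

text \<open>
  The set \<open>xA\<close> is \<open>range (mult x)\<close>. The notion is meant for ideals of commutative algebras,
  where \<open>xA = Ax\<close>.
\<close>

definition absorption_property :: "'a set \<Rightarrow> bool" where
  "absorption_property I \<longleftrightarrow> (\<forall>x. range (mult x) \<subseteq> I \<longrightarrow> x \<in> I)"

end

text \<open>
  The natural basis is given as a set. It may be infinite, and \<open>span\<close> consists of finite
  linear combinations.
\<close>

locale evolution_algebra = nonassoc_algebra scale mult
  for scale :: "'k::field \<Rightarrow> 'a::ab_group_add \<Rightarrow> 'a" (infixr \<open>*s\<close> 75)
    and mult :: "'a \<Rightarrow> 'a \<Rightarrow> 'a" (infixl \<open>\<bullet>\<close> 70) +
  fixes B :: "'a set"
  assumes independent_basis: "independent B"
    and span_basis: "span B = UNIV"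
    and natural_basis: "\<lbrakk>e \<in> B; f \<in> B; e \<noteq> f\<rbrakk> \<Longrightarrow> e \<bullet> f = 0"
begin

lemma mult_commute: "x \<bullet> y = y \<bullet> x"
proof -
  have zl: "0 \<bullet> z = 0" and zr: "z \<bullet> 0 = 0" for z
    using mult_add_left[of 0 0 z] mult_add_right[of z 0 0] by simp_all
  have basis: "e \<bullet> y = y \<bullet> e" if "e \<in> B" for e y
  proof -
    have "y \<in> span B" by (simp add: span_basis)
    then show ?thesis
    proof (induction rule: span_induct_alt)
      case base
      show ?case by (simp add: zl zr)
    next
      case (step c f y)
      have "e \<bullet> f = f \<bullet> e"
        using natural_basis that step.hyps by (cases "e = f") simp_all
      with step show ?case
        by (simp add: mult_add_left mult_add_right mult_scale_left mult_scale_right)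
    qed
  qed
  have "x \<in> span B" by (simp add: span_basis)
  then show ?thesis
  proof (induction rule: span_induct_alt)
    case base
    show ?case by (simp add: zl zr)
  next
    case (step c e x)
    then show ?case
      by (simp add: basis[OF step.hyps, of y] mult_add_left mult_add_right mult_scale_left mult_scale_right)
  qed
qed

definition H_of :: "'a set \<Rightarrow> 'a set" where
  "H_of I = {e \<in> B. e \<bullet> e \<in> I}"

definition I_H_of :: "'a set \<Rightarrow> 'a set" where
  "I_H_of I = span (H_of I)"

end

end

theory Submission
  imports Defs
begin

text \<open>
  Multiplication by a natural basis vector \<open>e\<close> sees only one coordinate: \<open>x \<bullet> e\<close> is the
  \<open>e\<close>-coordinate of \<open>x\<close> times \<open>e \<bullet> e\<close>. Hence, for a subspace \<open>I\<close>, the condition \<open>xA \<subseteq> I\<close> says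
  exactly that every \<open>e\<close> occurring in \<open>x\<close> satisfies \<open>e \<bullet> e \<in> I\<close>, so the elements \<open>x\<close> with
  \<open>xA \<subseteq> I\<close> form the span of \<open>H_of I\<close> (lemma \<open>range_mult_subset_iff\<close>). The absorption property
  therefore says \<open>span (H_of I) \<subseteq> I\<close>. When \<open>I\<close> is an ideal, the inclusions
  \<open>I \<subseteq> span (H_of I)\<close> and \<open>I \<inter> B \<subseteq> H_of I\<close> are automatic, and each of the three assertions
  reduces to the single inclusion \<open>H_of I \<subseteq> I\<close>.
\<close>

context evolution_algebra
begin

lemma mult_basis_eq_coordinate:
  assumes "e \<in> B"
  shows "x \<bullet> e = representation B x e *s (e \<bullet> e)"
proof -
  have "x \<in> span B" by (simp add: span_basis)
  then show ?thesis
  proof (induction rule: span_induct_alt)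
    case base
    have "0 \<bullet> e = 0" using mult_add_left[of 0 0 e] by simp
    then show ?case by (simp add: representation_zero)
  next
    case (step c f y)
    have "f \<bullet> e = representation B f e *s (e \<bullet> e)"
      using natural_basis[OF step.hyps assms] step.hyps
      by (simp add: representation_basis independent_basis)
    with step.IH show ?case
      by (simp add: mult_add_left mult_scale_left representation_add representation_scale
          independent_basis span_basis scale_left_distrib)
  qed
qed

text \<open>
  In the forward direction, a nonzero coordinate of \<open>x\<close> at \<open>e\<close> can be divided out of
  \<open>x \<bullet> e \<in> I\<close>. Conversely, \<open>e\<close> annihilates every other basis vector, so \<open>eA\<close> is contained in
  the line through \<open>e \<bullet> e\<close>.
\<close>

lemma range_mult_subset_iff:
  assumes I: "subspace I"
  shows "range (mult x) \<subseteq> I \<longleftrightarrow> x \<in> I_H_of I"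
proof
  assume sub: "range (mult x) \<subseteq> I"
  have "e \<in> H_of I" if nz: "representation B x e \<noteq> 0" for e
  proof -
    let ?c = "representation B x e"
    have e: "e \<in> B" using nz by (rule representation_ne_zero)
    have "?c *s (e \<bullet> e) \<in> I"
      using sub by (simp add: mult_basis_eq_coordinate[OF e, of x, symmetric] image_subset_iff)
    then have "inverse ?c *s ?c *s (e \<bullet> e) \<in> I"
      using I by (rule subspace_scale[rotated])
    with nz e show ?thesis by (simp add: H_of_def)
  qed
  then have "(\<Sum>e | representation B x e \<noteq> 0. representation B x e *s e) \<in> span (H_of I)"
    by (intro span_sum span_scale span_base) simp
  then show "x \<in> I_H_of I"
    by (simp add: I_H_of_def sum_nonzero_representation_eq independent_basis span_basis)
next
  assume x: "x \<in> I_H_of I"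
  have "x \<bullet> y \<in> I" for y
    using x unfolding I_H_of_def
  proof (induction rule: span_induct_alt)
    case base
    have "0 \<bullet> y = 0" using mult_add_left[of 0 0 y] by simp
    then show ?case using I by (simp add: subspace_0)
  next
    case (step c e z)
    have e: "e \<in> B" "e \<bullet> e \<in> I" using step.hyps by (auto simp: H_of_def)
    have "e \<bullet> y \<in> I"
      using mult_basis_eq_coordinate[OF e(1), of y] e(2) I
      by (simp add: mult_commute[of e y] subspace_scale)
    with step.IH I show ?case
      by (simp add: mult_add_left mult_scale_left subspace_add subspace_scale)
  qed
  then show "range (mult x) \<subseteq> I" by auto
qed

lemma ideal_subset_I_H_of:
  assumes "ideal I"
  shows "I \<subseteq> I_H_of I"
  using assms range_mult_subset_iff[of I] by (fastforce simp: ideal_def)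

lemma absorption_property_iff_H_of_subset:
  assumes "subspace I"
  shows "absorption_property I \<longleftrightarrow> H_of I \<subseteq> I"
proof -
  have "absorption_property I \<longleftrightarrow> I_H_of I \<subseteq> I"
    using range_mult_subset_iff[OF assms] by (auto simp: absorption_property_def)
  also have "\<dots> \<longleftrightarrow> H_of I \<subseteq> I"
    using assms span_minimal[of "H_of I" I] span_superset[of "H_of I"]
    by (auto simp: I_H_of_def)
  finally show ?thesis .
qed

lemma H_of_eq_iff_H_of_subset:
  assumes "ideal I"
  shows "H_of I = I \<inter> B \<longleftrightarrow> H_of I \<subseteq> I"
  using assms by (auto simp: H_of_def ideal_def)

lemma eq_I_H_of_iff_H_of_subset:
  assumes "ideal I"
  shows "I = I_H_of I \<longleftrightarrow> H_of I \<subseteq> I"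
proof
  assume "I = I_H_of I"
  then show "H_of I \<subseteq> I" using span_superset[of "H_of I"] by (simp add: I_H_of_def)
next
  assume "H_of I \<subseteq> I"
  then have "I_H_of I \<subseteq> I"
    using assms span_minimal by (simp add: I_H_of_def ideal_def)
  with ideal_subset_I_H_of[OF assms] show "I = I_H_of I" by (rule equalityI)
qed

end

theorem theorem5p5:
  fixes scale :: "'k::field \<Rightarrow> 'a::ab_group_add \<Rightarrow> 'a"
    and mult :: "'a \<Rightarrow> 'a \<Rightarrow> 'a"
    and B I :: "'a set"
  assumes "evolution_algebra scale mult B"
    and "nonassoc_algebra.ideal scale mult I"
  shows "(nonassoc_algebra.absorption_property mult I \<longleftrightarrow>
            evolution_algebra.H_of mult B I = I \<inter> B) \<and>
         (evolution_algebra.H_of mult B I = I \<inter> B \<longleftrightarrow>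
            I = evolution_algebra.I_H_of scale mult B I)"
proof -
  interpret evolution_algebra scale mult B by fact
  have "subspace I" using assms(2) by (simp add: ideal_def)
  then show ?thesis
    using absorption_property_iff_H_of_subset H_of_eq_iff_H_of_subset[OF assms(2)]
      eq_I_H_of_iff_H_of_subset[OF assms(2)]
    by simp
qed

end
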